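(* Let $\alpha,\beta,a,b\in\mathbb{R}$ and let $(a_n)_{n\ge0}$ be the sequence with $a_0=a$, $a_1=b$ and $a_{n+1}=\alpha a_n+\beta a_{n-1}$ for $n\ge1$. Let $\lambda_{1,2}=(\alpha\pm\sqrt{\alpha^2+4\beta})/2$ be the roots of $\lambda^2-\alpha\lambda-\beta=0$, assume $\lambda_1\ne\lambda_2$, and put $$A=\frac{b-a\lambda_2}{\lambda_1-\lambda_2},\qquad B=\frac{a\lambda_1-b}{\lambda_1-\lambda_2},$$ so that $a_n=A\lambda_1^n+B\lambda_2^n$ for all $n\ge0$. Let $b_n=\mathcal{L}(a)_n=a_n^2-a_{n+1}a_{n-1}$ for $n\ge1$. Then: (i) $b_n=-AB\,(\lambda_1\lambda_2)^{n-1}(\lambda_1-\lambda_2)^2$ for all $n\ge 1$; in particular $(b_n)$ is a geometric sequence. (ii) $\mathcal{L}^2(a)_n=0$ for all $n\ge2$. (iii) $(a_n)$ is $\infty$-log-concave if and only if $(a_n)$ is log-concave. (iv) $(a_n)$ is log-concave if and only if either ($\beta<0$ and $AB\le0$) or $AB=0$.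
   Context: For a real sequence $(a_n)_{n\ge0}$ the log-concave operator $\mathcal{L}$ is defined by $\mathcal{L}(a)_n=a_n^2-a_{n+1}a_{n-1}$ for $n\ge1$; its iterates are $\mathcal{L}^{1}=\mathcal{L}$ and $\mathcal{L}^{i+1}(a)_n=(\mathcal{L}^i(a)_n)^2-\mathcal{L}^i(a)_{n+1}\mathcal{L}^i(a)_{n-1}$, so $\mathcal{L}^i(a)_n$ is defined for $n\ge i$. The sequence is log-concave if $\mathcal{L}(a)_n\ge0$ for all $n\ge1$, and $\infty$-log-concave if $\mathcal{L}^i(a)_n\ge0$ for all $i\ge1$ and all $n\ge i$. Convention: $0^0=1$.
   Formalization: In (iv), "only if" is stated only for α²+4β>0 and β≠0; "if" is unrestricted. As printed it fails for α=1, β=0, a=0, b=1 (0,1,1,…: log-concave, AB=−1) and α=0, β=−1, a=1, b=0 (b_n=1, AB=1/4). *)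

theory Defs
  imports "HOL-Analysis.Analysis"
begin

text \<open>
  Sequences are total functions, so the value at index 0 (where n - 1 is truncated) is junk.
  The i-th iterate at an index n with i \<le> n uses only entries of the (i-1)-th iterate at
  indices at least i - 1, so junk values never enter the definitions below.
\<close>

definition logconc_op :: "(nat \<Rightarrow> real) \<Rightarrow> nat \<Rightarrow> real" where
  "logconc_op s n = (s n)\<^sup>2 - s (n + 1) * s (n - 1)"

definition log_concave :: "(nat \<Rightarrow> real) \<Rightarrow> bool" where
  "log_concave s \<longleftrightarrow> (\<forall>n\<ge>1. logconc_op s n \<ge> 0)"

definition infinitely_log_concave :: "(nat \<Rightarrow> real) \<Rightarrow> bool" where
  "infinitely_log_concave s \<longleftrightarrow> (\<forall>i\<ge>1. \<forall>n\<ge>i. (logconc_op ^^ i) s n \<ge> 0)"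

text \<open>Geometric sequences indexed from 1; the ratio may be 0.\<close>

definition geometric_from_1 :: "(nat \<Rightarrow> real) \<Rightarrow> bool" where
  "geometric_from_1 x \<longleftrightarrow> (\<exists>r. \<forall>n\<ge>1. x (n + 1) = r * x n)"

end

theory Submission
  imports Defs
begin

text \<open>
  By the recurrence, the sequence c(n) = s(n)^2 - s(n+1) s(n-1) is geometric with ratio -\<beta>, so
  the operator annihilates it and only the signs of c(1) and \<beta> matter. With D = \<alpha>^2 + 4\<beta> one has
  c(1) = -A B D and 4 c(1) = (2b - \<alpha>a)^2 - D a^2; the latter gives c(1) \<ge> 0 when D < 0, that is,
  when A and B are complex conjugates.
\<close>

text \<open>By Vieta both sides satisfy the same second-order recurrence, so agreement at 0 and 1
  suffices; the induction carries two consecutive values. A general field allows complex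
  roots.\<close>

lemma linear_recurrence_closed_form:
  fixes x :: "nat \<Rightarrow> 'a::field"
  assumes rec: "\<And>n. x (n + 2) = (l1 + l2) * x (n + 1) - l1 * l2 * x n"
    and ne: "l1 \<noteq> l2"
  shows "x n = (x 1 - x 0 * l2) / (l1 - l2) * l1 ^ n + (x 0 * l1 - x 1) / (l1 - l2) * l2 ^ n"
proof -
  define A where "A = (x 1 - x 0 * l2) / (l1 - l2)"
  define B where "B = (x 0 * l1 - x 1) / (l1 - l2)"
  have d: "l1 - l2 \<noteq> 0" using ne by simp
  have "A + B = (x 0 * (l1 - l2)) / (l1 - l2)"
    unfolding A_def B_def add_divide_distrib[symmetric] by (simp add: algebra_simps)
  then have 0: "x 0 = A + B" using d by simp
  have "A * l1 + B * l2 = (x 1 * (l1 - l2)) / (l1 - l2)"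
    unfolding A_def B_def times_divide_eq_left add_divide_distrib[symmetric]
    by (simp add: algebra_simps)
  then have 1: "x 1 = A * l1 + B * l2" using d by simp
  have "x n = A * l1 ^ n + B * l2 ^ n \<and> x (n + 1) = A * l1 ^ (n + 1) + B * l2 ^ (n + 1)"
  proof (induction n)
    case 0
    then show ?case using \<open>x 0 = A + B\<close> 1 by simp
  next
    case (Suc n)
    then show ?case using rec[of n] by (simp add: algebra_simps)
  qed
  then show ?thesis unfolding A_def B_def by blast
qed

text \<open>Up to sign, \<open>logconc_op s n\<close> is the determinant of the matrix with rows
  (s(n+1), s(n)) and (s(n), s(n-1)); raising n by one multiplies it by the companion matrix, of
  determinant -\<beta>.\<close>

lemma logconc_op_linear_recurrence:
  assumes rec: "\<And>n. n \<ge> 1 \<Longrightarrow> s (n + 1) = \<alpha> * s n + \<beta> * s (n - 1)"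
  shows "logconc_op s (Suc n) = (- \<beta>) ^ n * logconc_op s 1"
proof (induction n)
  case (Suc n)
  have "logconc_op s (Suc (Suc n)) = - \<beta> * logconc_op s (Suc n)"
    using rec[of "Suc n"] rec[of "Suc (Suc n)"]
    by (simp add: logconc_op_def power2_eq_square algebra_simps)
  then show ?case using Suc by simp
qed simp

text \<open>Zeros persist: for n \<ge> i + 1, iterate i + 1 at n reads iterate i only at n - 1, n
  and n + 1, all at least i.\<close>

lemma logconc_op_iterate_eq_0:
  assumes "\<And>n. n \<ge> k \<Longrightarrow> (logconc_op ^^ k) s n = 0" and "k \<le> i" and "i \<le> n"
  shows "(logconc_op ^^ i) s n = 0"
  using assms(2,3)
proof (induction i arbitrary: n rule: dec_induct)
  case base
  then show ?case using assms(1) by simp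
next
  case (step i)
  then show ?case by (simp add: logconc_op_def)
qed

text \<open>The converse of the sign criterion fails outside the stated range. If \<beta> = 0, then
  b1 > 0 still gives log-concavity, but A B = -b1 / D is nonzero. If D < 0, then \<beta> < 0 and
  every such sequence is log-concave, yet A B > 0 unless a = b = 0.\<close>

theorem theorem5p1:
  fixes \<alpha> \<beta> a b :: real
    and s :: "nat \<Rightarrow> real"
    and lam1 lam2 A B :: complex
  assumes "s 0 = a" and "s 1 = b"
    and "\<And>n. n \<ge> 1 \<Longrightarrow> s (n + 1) = \<alpha> * s n + \<beta> * s (n - 1)"
    and "lam1 = (of_real \<alpha> + csqrt (of_real (\<alpha>\<^sup>2 + 4 * \<beta>))) / 2"
    and "lam2 = (of_real \<alpha> - csqrt (of_real (\<alpha>\<^sup>2 + 4 * \<beta>))) / 2"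
    and "lam1 \<noteq> lam2"
    and "A = (of_real b - of_real a * lam2) / (lam1 - lam2)"
    and "B = (of_real a * lam1 - of_real b) / (lam1 - lam2)"
  shows "(\<forall>n. of_real (s n) = A * lam1 ^ n + B * lam2 ^ n)
    \<and> ((\<forall>n\<ge>1. of_real (logconc_op s n) = - (A * B) * (lam1 * lam2) ^ (n - 1) * (lam1 - lam2)\<^sup>2)
        \<and> geometric_from_1 (logconc_op s))
    \<and> (\<forall>n\<ge>2. (logconc_op ^^ 2) s n = 0)
    \<and> (infinitely_log_concave s \<longleftrightarrow> log_concave s)
    \<and> ((\<beta> < 0 \<and> A * B \<in> \<real>\<^sub>\<le>\<^sub>0) \<or> A * B = 0 \<longrightarrow> log_concave s)
    \<and> (\<alpha>\<^sup>2 + 4 * \<beta> > 0 \<and> \<beta> \<noteq> 0 \<longrightarrow>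
        (log_concave s \<longleftrightarrow> (\<beta> < 0 \<and> A * B \<in> \<real>\<^sub>\<le>\<^sub>0) \<or> A * B = 0))"
proof -
  note rec = assms(3) and l1 = assms(4) and l2 = assms(5) and ne = assms(6)
    and A = assms(7) and B = assms(8)
  define D where "D = \<alpha>\<^sup>2 + 4 * \<beta>"
  define b1 where "b1 = logconc_op s 1"
  have sum: "lam1 + lam2 = of_real \<alpha>" unfolding l1 l2 by (simp add: field_simps)
  have diff: "lam1 - lam2 = csqrt (of_real D)" unfolding l1 l2 D_def by (simp add: field_simps)
  have diff2: "(lam1 - lam2)\<^sup>2 = of_real D" unfolding diff by simp
  have "4 * (lam1 * lam2) = (lam1 + lam2)\<^sup>2 - (lam1 - lam2)\<^sup>2"
    by (simp add: power2_eq_square algebra_simps)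
  also have "\<dots> = 4 * of_real (- \<beta>)" unfolding sum diff2 D_def by simp
  finally have prod: "lam1 * lam2 = of_real (- \<beta>)" by simp
  have D0: "D \<noteq> 0" using ne diff by auto
  have b1: "b1 = b\<^sup>2 - \<alpha> * a * b - \<beta> * a\<^sup>2"
    using rec[of 1] assms(1,2)
    by (simp add: b1_def logconc_op_def power2_eq_square algebra_simps)
  \<comment> \<open>Completing the square: \<open>b1\<close> is a quadratic form in a, b of
    discriminant D.\<close>
  have b1_sq: "4 * b1 = (2 * b - \<alpha> * a)\<^sup>2 - D * a\<^sup>2"
    unfolding b1 D_def by (simp add: power2_eq_square algebra_simps)
  \<comment> \<open>The product of the numerators is symmetric in the roots, so A B is real even for
    complex roots.\<close>
  have AB: "A * B = of_real (- b1 / D)"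
  proof -
    have "A * B * (lam1 - lam2)\<^sup>2 = (of_real b - of_real a * lam2) * (of_real a * lam1 - of_real b)"
      using ne unfolding A B by (simp add: power2_eq_square)
    also have "\<dots> = of_real a * of_real b * (lam1 + lam2) - (of_real a)\<^sup>2 * (lam1 * lam2)
        - (of_real b)\<^sup>2"
      by (simp add: power2_eq_square algebra_simps)
    also have "\<dots> = of_real (- b1)"
      unfolding sum prod b1 by (simp add: algebra_simps)
    finally show ?thesis using D0 by (simp add: diff2 field_simps)
  qed
  have AB0: "A * B = 0 \<longleftrightarrow> b1 = 0"
    unfolding AB of_real_eq_0_iff using D0 by simp
  have ABneg: "A * B \<in> \<real>\<^sub>\<le>\<^sub>0 \<longleftrightarrow> - b1 / D \<le> 0"
    unfolding AB by (rule nonpos_Reals_of_real_iff)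
  have geo: "logconc_op s n = (- \<beta>) ^ (n - 1) * b1" if "n \<ge> 1" for n
    using logconc_op_linear_recurrence[OF rec, of "n - 1"] that by (simp add: b1_def)
  have closed: "of_real (s n) = A * lam1 ^ n + B * lam2 ^ n" for n
  proof -
    have "of_real (s (k + 2))
        = (lam1 + lam2) * of_real (s (k + 1)) - lam1 * lam2 * of_real (s k)" for k
      using rec[of "k + 1"] unfolding sum prod by simp
    from linear_recurrence_closed_form[OF this ne, of n] show ?thesis
      unfolding A B assms(1,2) .
  qed
  have closed_b: "of_real (logconc_op s n)
      = - (A * B) * (lam1 * lam2) ^ (n - 1) * (lam1 - lam2)\<^sup>2" if "n \<ge> 1" for n
    unfolding AB prod diff2 geo[OF that] using D0 by simp
  have step: "logconc_op s (n + 1) = - \<beta> * logconc_op s n" if "n \<ge> 1" for n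
    using that by (cases n) (simp_all add: geo)
  then have geom: "geometric_from_1 (logconc_op s)"
    unfolding geometric_from_1_def by blast
  have L2: "(logconc_op ^^ 2) s n = 0" if "n \<ge> 2" for n
  proof -
    \<comment> \<open>With n = m + 2 the neighbours m + 1 and m + 3 involve no truncated
      subtraction, and \<open>geo\<close> covers all three indices.\<close>
    define m where "m = n - 2"
    have n: "n = m + 2" using that by (simp add: m_def)
    have "(logconc_op ^^ 2) s n = logconc_op (logconc_op s) n"
      by (simp only: numeral_2_eq_2 funpow.simps o_apply id_apply)
    also have "\<dots> = (logconc_op s (m + 2))\<^sup>2 - logconc_op s (m + 3) * logconc_op s (m + 1)"
      unfolding logconc_op_def[of "logconc_op s"] n by (simp add: numeral_3_eq_3)
    also have "\<dots> = 0"
      by (simp add: geo power2_eq_square numeral_3_eq_3)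
    finally show ?thesis .
  qed
  have inf: "infinitely_log_concave s \<longleftrightarrow> log_concave s"
  proof
    assume "infinitely_log_concave s"
    then have "\<forall>n\<ge>1. (logconc_op ^^ 1) s n \<ge> 0"
      unfolding infinitely_log_concave_def by blast
    then show "log_concave s" by (simp add: log_concave_def)
  next
    assume lc: "log_concave s"
    have "(logconc_op ^^ i) s n \<ge> 0" if "i \<ge> 1" "n \<ge> i" for i n
    proof (cases "i = 1")
      case True
      then show ?thesis using lc that by (simp add: log_concave_def)
    next
      case False
      then have "2 \<le> i" using that by simp
      then have "(logconc_op ^^ i) s n = 0"
        using logconc_op_iterate_eq_0[OF L2] that by blast
      then show ?thesis by simp
    qed
    then show "infinitely_log_concave s" unfolding infinitely_log_concave_def by blast
  qed
  have suff: "log_concave s" if "(\<beta> < 0 \<and> A * B \<in> \<real>\<^sub>\<le>\<^sub>0) \<or> A * B = 0"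
  proof (cases "b1 = 0")
    case True
    then show ?thesis by (simp add: log_concave_def geo)
  next
    case False
    with that have neg: "\<beta> < 0" and q: "- b1 / D \<le> 0" unfolding AB0 ABneg by blast+
    have "b1 \<ge> 0"
    \<comment> \<open>For D > 0 the sign of A B decides; for D < 0 the right side of
      \<open>b1_sq\<close> is a sum of nonnegative terms.\<close>
    proof (cases "D > 0")
      case True
      then show ?thesis using q by (simp add: field_simps)
    next
      case False
      then have "D * a\<^sup>2 \<le> 0" by (simp add: mult_nonpos_nonneg)
      then show ?thesis using b1_sq zero_le_power2[of "2 * b - \<alpha> * a"] by linarith
    qed
    then show ?thesis using neg by (simp add: log_concave_def geo)
  qed
  have nec: "(\<beta> < 0 \<and> A * B \<in> \<real>\<^sub>\<le>\<^sub>0) \<or> A * B = 0"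
    if D: "D > 0" and beta: "\<beta> \<noteq> 0" and lc: "log_concave s"
  proof -
    \<comment> \<open>The first two terms, b1 and -\<beta> b1, already give all sign information: if
      \<beta> > 0 they force b1 = 0.\<close>
    have "logconc_op s 1 \<ge> 0" "logconc_op s 2 \<ge> 0"
      using lc by (simp_all add: log_concave_def)
    then have "b1 \<ge> 0" and b2: "\<beta> * b1 \<le> 0"
      by (simp_all add: geo)
    show ?thesis
    proof (cases "\<beta> < 0")
      case True
      then show ?thesis using \<open>b1 \<ge> 0\<close> D unfolding ABneg by simp
    next
      case False
      then have "b1 = 0" using beta b2 \<open>b1 \<ge> 0\<close> by (simp add: mult_le_0_iff)
      then show ?thesis unfolding AB0 by blast
    qed
  qed
  show ?thesis
    using closed closed_b geom L2 inf suff nec unfolding D_def by blast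
qed

end
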